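(* Let $\kappa<0$. There are no Lagrangian relative equilibria in $\mathbb H_\kappa^2$ with two bodies of equal mass ($m_1=m_2=m>0$) and a third body of negligible mass ($m_3=0$).
   Context: For $\kappa<0$ let $\mathbb H_\kappa^2=\{(x,y,z) : \kappa(x^2+y^2-z^2)+2|\kappa|^{1/2}z=0,\ z\ge0\}$, embedded in Minkowski space $\mathbb R^{2,1}$ with the Lorentz inner product of signature $(+,+,-)$. Bodies have positions ${\bf r}_i=(x_i,y_i,z_i)\in\mathbb H_\kappa^2$. With $r_{ij}=[(x_i-x_j)^2+(y_i-y_j)^2-(z_i-z_j)^2]^{1/2}$ and $\dot{\bf r}_i\cdot\dot{\bf r}_i=\dot x_i^2+\dot y_i^2-\dot z_i^2$, the equations of motion of the curved 3-body problem are, for $i=1,2,3$, $$\ddot x_i=\sum_{j\ne i}\frac{m_j\big[x_j-\big(1-\frac{\kappa r_{ij}^2}{2}\big)x_i\big]}{r_{ij}^3\big(1-\frac{\kappa r_{ij}^2}{4}\big)^{3/2}}-\kappa(\dot{\bf r}_i\cdot\dot{\bf r}_i)x_i,$$ the same equation with $y$ in place of $x$, and $$\ddot z_i=\sum_{j\ne i}\frac{m_j\big[z_j-\big(1-\frac{\kappa r_{ij}^2}{2}\big)z_i-\frac{|\kappa|^{1/2}r_{ij}^2}{2}\big]}{r_{ij}^3\big(1-\frac{\kappa r_{ij}^2}{4}\big)^{3/2}}-(\dot{\bf r}_i\cdot\dot{\bf r}_i)(\kappa z_i-|\kappa|^{1/2}).$$ Collisions are excluded. A negligible mass is a mass set equal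 to $0$ in these equations. With one negligible mass $m_3=0$, a Lagrangian relative equilibrium is a solution of the form $$(x_1,y_1)=(r_1\cos\alpha t,\ r_1\sin\alpha t),\quad (x_2,y_2)=(-r_2\cos\alpha t,\ -r_2\sin\alpha t),\quad (x_3,y_3)=(r_3\cos(\alpha t+\theta),\ r_3\sin(\alpha t+\theta)),$$ with constants $\alpha\ne0$, $\theta\in(0,\pi)$, $r_1,r_2,r_3>0$ (and $z_i\ge0$ determined by $(x_i,y_i)$ through the equation of $\mathbb H_\kappa^2$), such that the triangle is equilateral: $r_{12}=r_{13}=r_{23}$. *)

theory Defs
  imports "HOL-Analysis.Analysis"
begin

text \<open>
  Points of Minkowski space \<open>\<real>\<^bsup>2,1\<^esup>\<close> are vectors \<open>(x, y, z)\<close> of type \<^typ>\<open>real^3\<close>, the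
  coordinates being \<open>q $ 1\<close>, \<open>q $ 2\<close>, \<open>q $ 3\<close>. The three bodies are indexed by the same
  three-element type, whose elements are \<open>1\<close>, \<open>2\<close> and \<open>3\<close>.
\<close>

definition lorentz :: "real^3 \<Rightarrow> real^3 \<Rightarrow> real" where
  "lorentz u v = u $ 1 * v $ 1 + u $ 2 * v $ 2 - u $ 3 * v $ 3"

definition hyperbolic_sphere :: "real \<Rightarrow> (real^3) set" where
  "hyperbolic_sphere \<kappa> =
     {q. \<kappa> * ((q $ 1)\<^sup>2 + (q $ 2)\<^sup>2 - (q $ 3)\<^sup>2) + 2 * sqrt \<bar>\<kappa>\<bar> * q $ 3 = 0 \<and> q $ 3 \<ge> 0}"

text \<open>
  The radicand is nonnegative for points of \<^term>\<open>hyperbolic_sphere \<kappa>\<close> with \<open>\<kappa> < 0\<close>.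
\<close>

definition chord :: "real^3 \<Rightarrow> real^3 \<Rightarrow> real" where
  "chord p q = sqrt (lorentz (p - q) (p - q))"

text \<open>
  Right-hand side of the equations of motion of body \<open>i\<close>, for masses \<open>m\<close>, positions \<open>q\<close>
  and velocities \<open>v\<close>.
\<close>

definition curved_acceleration ::
  "real \<Rightarrow> (3 \<Rightarrow> real) \<Rightarrow> (3 \<Rightarrow> real^3) \<Rightarrow> (3 \<Rightarrow> real^3) \<Rightarrow> 3 \<Rightarrow> real^3" where
  "curved_acceleration \<kappa> m q v i = vector
     [(\<Sum>j\<in>UNIV - {i}.
         m j * (q j $ 1 - (1 - \<kappa> * (chord (q i) (q j))\<^sup>2 / 2) * q i $ 1)
         / (chord (q i) (q j) ^ 3 * (1 - \<kappa> * (chord (q i) (q j))\<^sup>2 / 4) powr (3 / 2)))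
       - \<kappa> * lorentz (v i) (v i) * q i $ 1,
      (\<Sum>j\<in>UNIV - {i}.
         m j * (q j $ 2 - (1 - \<kappa> * (chord (q i) (q j))\<^sup>2 / 2) * q i $ 2)
         / (chord (q i) (q j) ^ 3 * (1 - \<kappa> * (chord (q i) (q j))\<^sup>2 / 4) powr (3 / 2)))
       - \<kappa> * lorentz (v i) (v i) * q i $ 2,
      (\<Sum>j\<in>UNIV - {i}.
         m j * (q j $ 3 - (1 - \<kappa> * (chord (q i) (q j))\<^sup>2 / 2) * q i $ 3
                - sqrt \<bar>\<kappa>\<bar> * (chord (q i) (q j))\<^sup>2 / 2)
         / (chord (q i) (q j) ^ 3 * (1 - \<kappa> * (chord (q i) (q j))\<^sup>2 / 4) powr (3 / 2)))
       - lorentz (v i) (v i) * (\<kappa> * q i $ 3 - sqrt \<bar>\<kappa>\<bar>)]"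

text \<open>
  No sign condition is put on the masses; a negligible mass is one equal to \<open>0\<close>.
\<close>

definition curved_3body_solution ::
  "real \<Rightarrow> (3 \<Rightarrow> real) \<Rightarrow> (3 \<Rightarrow> real \<Rightarrow> real^3) \<Rightarrow> bool" where
  "curved_3body_solution \<kappa> m q \<longleftrightarrow>
     (\<forall>i t. q i t \<in> hyperbolic_sphere \<kappa>) \<and>
     (\<forall>i j t. i \<noteq> j \<longrightarrow> q i t \<noteq> q j t) \<and>
     (\<exists>v. \<forall>i t.
        (q i has_vector_derivative v i t) (at t) \<and>
        (v i has_vector_derivative
           curved_acceleration \<kappa> m (\<lambda>j. q j t) (\<lambda>j. v j t) i) (at t))"

text \<open>
  The notion for a system whose third mass is negligible: bodies \<open>1\<close> and \<open>2\<close> lie on opposite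
  sides of the axis of rotation. The coordinate \<open>q i t $ 3\<close> is determined by the other two,
  since a solution stays in \<^term>\<open>hyperbolic_sphere \<kappa>\<close>.
\<close>

definition lagrangian_relative_equilibrium ::
  "real \<Rightarrow> (3 \<Rightarrow> real) \<Rightarrow> (3 \<Rightarrow> real \<Rightarrow> real^3) \<Rightarrow> bool" where
  "lagrangian_relative_equilibrium \<kappa> m q \<longleftrightarrow>
     curved_3body_solution \<kappa> m q \<and>
     (\<exists>\<alpha> \<theta> r\<^sub>1 r\<^sub>2 r\<^sub>3.
        \<alpha> \<noteq> 0 \<and> 0 < \<theta> \<and> \<theta> < pi \<and> r\<^sub>1 > 0 \<and> r\<^sub>2 > 0 \<and> r\<^sub>3 > 0 \<and>
        (\<forall>t. q 1 t $ 1 = r\<^sub>1 * cos (\<alpha> * t) \<and> q 1 t $ 2 = r\<^sub>1 * sin (\<alpha> * t) \<and>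
             q 2 t $ 1 = - r\<^sub>2 * cos (\<alpha> * t) \<and> q 2 t $ 2 = - r\<^sub>2 * sin (\<alpha> * t) \<and>
             q 3 t $ 1 = r\<^sub>3 * cos (\<alpha> * t + \<theta>) \<and> q 3 t $ 2 = r\<^sub>3 * sin (\<alpha> * t + \<theta>))) \<and>
     (\<forall>t. chord (q 1 t) (q 2 t) = chord (q 1 t) (q 3 t) \<and>
          chord (q 1 t) (q 3 t) = chord (q 2 t) (q 3 t))"

end

theory Submission
  imports Defs
begin

text \<open>
  With \<open>s = sqrt \<bar>\<kappa>\<bar>\<close> and \<open>h = s z + 1\<close>, the surface is \<open>h\<^sup>2 = 1 + s\<^sup>2 (x\<^sup>2 + y\<^sup>2)\<close>. The equations of
  motion of body \<open>3\<close>, taken radially and transversally, give \<open>\<alpha>\<^sup>2 h\<^sub>3\<^sup>2 = 2 k c\<close> and \<open>r\<^sub>1 = r\<^sub>2\<close>,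
  where \<open>c = 1 + s\<^sup>2 \<rho>\<^sup>2 / 2\<close> for the side \<open>\<rho>\<close> of the triangle and \<open>k\<close> is a nonzero constant. Body \<open>1\<close>
  gives \<open>\<alpha>\<^sup>2 h\<^sub>1\<^sup>2 = k (1 + c)\<close>, and the equality of the sides gives \<open>c = 2 h\<^sub>1\<^sup>2 - 1 = h\<^sub>1 h\<^sub>3\<close>.
  Eliminating \<open>k\<close> and \<open>h\<^sub>3\<close> leaves \<open>h\<^sub>1\<^sup>2 = 1\<close>, that is, \<open>r\<^sub>1 = 0\<close>.
\<close>

text \<open>Complete the square in \<open>z\<close> in the defining equation, with
  \<open>- \<kappa>\<close> as the square of \<open>sqrt \<bar>\<kappa>\<bar>\<close>. Positivity
  makes the shifted height recoverable from its square.\<close>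

lemma hyperbolic_sphere_height:
  assumes "\<kappa> < 0" and "q \<in> hyperbolic_sphere \<kappa>"
  shows "(sqrt \<bar>\<kappa>\<bar> * q $ 3 + 1)\<^sup>2 = 1 - \<kappa> * ((q $ 1)\<^sup>2 + (q $ 2)\<^sup>2)"
    and "sqrt \<bar>\<kappa>\<bar> * q $ 3 + 1 > 0"
proof -
  have "(sqrt \<bar>\<kappa>\<bar>)\<^sup>2 = - \<kappa>"
    using assms(1) by simp
  then show "(sqrt \<bar>\<kappa>\<bar> * q $ 3 + 1)\<^sup>2 = 1 - \<kappa> * ((q $ 1)\<^sup>2 + (q $ 2)\<^sup>2)"
    using assms(2)
    by (simp add: hyperbolic_sphere_def power2_sum power_mult_distrib algebra_simps)
  have "sqrt \<bar>\<kappa>\<bar> * q $ 3 \<ge> 0"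
    using assms(2) by (simp add: hyperbolic_sphere_def)
  then show "sqrt \<bar>\<kappa>\<bar> * q $ 3 + 1 > 0"
    by simp
qed

lemma hyperbolic_sphere_height_unique:
  assumes "\<kappa> < 0" and "p \<in> hyperbolic_sphere \<kappa>" and "q \<in> hyperbolic_sphere \<kappa>"
    and "(p $ 1)\<^sup>2 + (p $ 2)\<^sup>2 = (q $ 1)\<^sup>2 + (q $ 2)\<^sup>2"
  shows "p $ 3 = q $ 3"
proof -
  have "(sqrt \<bar>\<kappa>\<bar> * p $ 3 + 1)\<^sup>2 = (sqrt \<bar>\<kappa>\<bar> * q $ 3 + 1)\<^sup>2"
    using hyperbolic_sphere_height(1)[OF assms(1,2)] hyperbolic_sphere_height(1)[OF assms(1,3)]
      assms(4) by simp
  then have "sqrt \<bar>\<kappa>\<bar> * p $ 3 + 1 = sqrt \<bar>\<kappa>\<bar> * q $ 3 + 1"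
    using hyperbolic_sphere_height(2)[OF assms(1,2)] hyperbolic_sphere_height(2)[OF assms(1,3)]
      power2_eq_imp_eq by (meson less_imp_le)
  then show ?thesis
    using assms(1) by simp
qed

text \<open>A constant distance from the axis forces a constant height, so the velocity is
  horizontal and its Lorentz square is Euclidean. The phase \<open>\<theta>\<close> lets one lemma
  serve both bodies 1 and 3.\<close>

lemma circular_motion:
  fixes q v :: "real \<Rightarrow> real^3"
  assumes "\<kappa> < 0" and sphere: "\<And>t. q t \<in> hyperbolic_sphere \<kappa>"
    and q1: "\<And>t. q t $ 1 = r * cos (\<alpha> * t + \<theta>)"
    and q2: "\<And>t. q t $ 2 = r * sin (\<alpha> * t + \<theta>)"
    and v: "\<And>t. (q has_vector_derivative v t) (at t)"
    and a: "(v has_vector_derivative a) (at t)"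
  shows "a $ 1 = - \<alpha>\<^sup>2 * q t $ 1" and "a $ 2 = - \<alpha>\<^sup>2 * q t $ 2"
    and "lorentz (v t) (v t) = \<alpha>\<^sup>2 * r\<^sup>2"
proof -
  have nth: "((\<lambda>t. f t $ k) has_real_derivative f' $ k) (at t)"
    if "(f has_vector_derivative f') (at t)" for f :: "real \<Rightarrow> real^3" and f' k t
    using bounded_linear.has_vector_derivative[OF bounded_linear_vec_nth that]
    by (simp add: has_real_derivative_iff_has_vector_derivative)
  have v1: "v t $ 1 = - \<alpha> * r * sin (\<alpha> * t + \<theta>)" for t
  proof (rule DERIV_unique[OF nth[OF v]])
    show "((\<lambda>t. q t $ 1) has_real_derivative - \<alpha> * r * sin (\<alpha> * t + \<theta>)) (at t)"
      unfolding q1 by (auto intro!: derivative_eq_intros)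
  qed
  have v2: "v t $ 2 = \<alpha> * r * cos (\<alpha> * t + \<theta>)" for t
  proof (rule DERIV_unique[OF nth[OF v]])
    show "((\<lambda>t. q t $ 2) has_real_derivative \<alpha> * r * cos (\<alpha> * t + \<theta>)) (at t)"
      unfolding q2 by (auto intro!: derivative_eq_intros)
  qed
  have radius: "(q t $ 1)\<^sup>2 + (q t $ 2)\<^sup>2 = r\<^sup>2" for t
    by (simp add: q1 q2 power_mult_distrib flip: distrib_left)
  have "q t $ 3 = q 0 $ 3" for t
    using hyperbolic_sphere_height_unique[OF assms(1) sphere sphere] radius by metis
  then obtain z where "\<And>t. q t $ 3 = z"
    by blast
  then have "((\<lambda>t. q t $ 3) has_real_derivative 0) (at t)"
    by simp
  with nth[OF v] have v3: "v t $ 3 = 0"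
    by (rule DERIV_unique)
  show "lorentz (v t) (v t) = \<alpha>\<^sup>2 * r\<^sup>2"
  proof -
    have "lorentz (v t) (v t)
      = \<alpha>\<^sup>2 * r\<^sup>2 * ((sin (\<alpha> * t + \<theta>))\<^sup>2 + (cos (\<alpha> * t + \<theta>))\<^sup>2)"
      unfolding lorentz_def v1 v2 v3 by algebra
    then show ?thesis
      by simp
  qed
  show "a $ 1 = - \<alpha>\<^sup>2 * q t $ 1"
  proof (rule DERIV_unique[OF nth[OF a]])
    show "((\<lambda>t. v t $ 1) has_real_derivative - \<alpha>\<^sup>2 * q t $ 1) (at t)"
      unfolding v1 q1 by (auto intro!: derivative_eq_intros simp: power2_eq_square)
  qed
  show "a $ 2 = - \<alpha>\<^sup>2 * q t $ 2"
  proof (rule DERIV_unique[OF nth[OF a]])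
    show "((\<lambda>t. v t $ 2) has_real_derivative - \<alpha>\<^sup>2 * q t $ 2) (at t)"
      unfolding v2 q2 by (auto intro!: derivative_eq_intros simp: power2_eq_square)
  qed
qed

theorem theorem7:
  fixes \<kappa> :: real and m :: "3 \<Rightarrow> real"
  assumes "\<kappa> < 0"
    and "m 1 = m 2" and "m 1 > 0" and "m 3 = 0"
  shows "\<not> (\<exists>q. lagrangian_relative_equilibrium \<kappa> m q)"
proof
  assume "\<exists>q. lagrangian_relative_equilibrium \<kappa> m q"
  then obtain q \<alpha> \<theta> r\<^sub>1 r\<^sub>2 r\<^sub>3 where sol: "curved_3body_solution \<kappa> m q"
    and "\<alpha> \<noteq> 0" "0 < \<theta>" "\<theta> < pi" "r\<^sub>1 > 0" "r\<^sub>2 > 0" "r\<^sub>3 > 0"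
    and q: "\<And>t. q 1 t $ 1 = r\<^sub>1 * cos (\<alpha> * t)" "\<And>t. q 1 t $ 2 = r\<^sub>1 * sin (\<alpha> * t)"
      "\<And>t. q 2 t $ 1 = - r\<^sub>2 * cos (\<alpha> * t)" "\<And>t. q 2 t $ 2 = - r\<^sub>2 * sin (\<alpha> * t)"
      "\<And>t. q 3 t $ 1 = r\<^sub>3 * cos (\<alpha> * t + \<theta>)" "\<And>t. q 3 t $ 2 = r\<^sub>3 * sin (\<alpha> * t + \<theta>)"
    and sides: "chord (q 1 0) (q 2 0) = chord (q 1 0) (q 3 0)"
      "chord (q 1 0) (q 3 0) = chord (q 2 0) (q 3 0)"
    unfolding lagrangian_relative_equilibrium_def by blast
  from sol obtain v where sphere: "\<And>i t. q i t \<in> hyperbolic_sphere \<kappa>"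
    and v: "\<And>i t. (q i has_vector_derivative v i t) (at t)"
    and a: "\<And>i t. (v i has_vector_derivative
           curved_acceleration \<kappa> m (\<lambda>j. q j t) (\<lambda>j. v j t) i) (at t)"
    unfolding curved_3body_solution_def by blast
  define \<rho> where "\<rho> = chord (q 1 0) (q 2 0)"
  \<comment> \<open>The factor common to all force terms of bodies 1 and 2: their masses agree and
    every side is \<open>\<rho>\<close>.\<close>
  define k where "k = m 1 / (\<rho> ^ 3 * (1 - \<kappa> * \<rho>\<^sup>2 / 4) powr (3 / 2))"
  define c where "c = 1 - \<kappa> * \<rho>\<^sup>2 / 2"
  define h where "h i = sqrt \<bar>\<kappa>\<bar> * q i 0 $ 3 + 1" for i
  have chords: "chord (q 1 0) (q 2 0) = \<rho>" "chord (q 1 0) (q 3 0) = \<rho>"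
    "chord (q 3 0) (q 1 0) = \<rho>" "chord (q 3 0) (q 2 0) = \<rho>"
    using sides by (auto simp: \<rho>_def chord_def lorentz_def algebra_simps)
  have others: "UNIV - {1} = {2, 3 :: 3}" "UNIV - {3} = {1, 2 :: 3}"
    unfolding UNIV_3 by auto
  have s2: "(sqrt \<bar>\<kappa>\<bar>)\<^sup>2 = - \<kappa>"
    using assms(1) by simp
  have sin\<theta>: "sin \<theta> > 0"
    using \<open>0 < \<theta>\<close> \<open>\<theta> < pi\<close> by (rule sin_gt_zero)
  note motion1 = circular_motion[of _ "q 1" r\<^sub>1 \<alpha> 0, OF assms(1) sphere _ _ v a, of 0,
      simplified, OF q(1,2)]
  note motion3 = circular_motion[of _ "q 3" r\<^sub>3 \<alpha> \<theta>, OF assms(1) sphere q(5,6) v a, of 0]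
  \<comment> \<open>At time 0 bodies 1 and 2 sit on the x-axis, at \<open>r\<^sub>1\<close> and
    \<open>- r\<^sub>2\<close>; body 3 exerts no force.\<close>
  have body1: "- \<alpha>\<^sup>2 * r\<^sub>1 = k * (- r\<^sub>2 - c * r\<^sub>1) - \<kappa> * (\<alpha>\<^sup>2 * r\<^sub>1\<^sup>2) * r\<^sub>1"
    using motion1(1) assms(2,4) unfolding curved_acceleration_def motion1(3)
    by (simp add: others chords q k_def c_def)
  have body3: "- \<alpha>\<^sup>2 * (r\<^sub>3 * cos \<theta>)
      = k * (r\<^sub>1 - c * (r\<^sub>3 * cos \<theta>)) + k * (- r\<^sub>2 - c * (r\<^sub>3 * cos \<theta>))
        - \<kappa> * (\<alpha>\<^sup>2 * r\<^sub>3\<^sup>2) * (r\<^sub>3 * cos \<theta>)"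
    "- \<alpha>\<^sup>2 * (r\<^sub>3 * sin \<theta>)
      = - 2 * k * c * (r\<^sub>3 * sin \<theta>) - \<kappa> * (\<alpha>\<^sup>2 * r\<^sub>3\<^sup>2) * (r\<^sub>3 * sin \<theta>)"
    using motion3(1,2) assms(2) unfolding curved_acceleration_def motion3(3)
    by (simp_all add: others chords q k_def c_def mult_ac)
  have h1: "(h 1)\<^sup>2 = 1 - \<kappa> * r\<^sub>1\<^sup>2"
    using hyperbolic_sphere_height(1)[OF assms(1) sphere, of 1 0]
    by (simp add: h_def q)
  have h3: "(h 3)\<^sup>2 = 1 - \<kappa> * r\<^sub>3\<^sup>2"
    using hyperbolic_sphere_height(1)[OF assms(1) sphere, of 3 0]
    by (simp add: h_def q power_mult_distrib flip: distrib_left)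
  have pos: "h i > 0" for i
    using hyperbolic_sphere_height(2)[OF assms(1) sphere] by (simp add: h_def)
  \<comment> \<open>Bodies 1 and 2 have y-coordinate 0, so every term of the y-equation carries the
    factor \<open>r\<^sub>3 * sin \<theta>\<close>.\<close>
  have "r\<^sub>3 * sin \<theta> * (\<alpha>\<^sup>2 * (h 3)\<^sup>2 - 2 * k * c) = 0"
    using body3(2) unfolding h3 by (simp add: algebra_simps)
  then have e3: "\<alpha>\<^sup>2 * (h 3)\<^sup>2 = 2 * k * c"
    using sin\<theta> \<open>r\<^sub>3 > 0\<close> by simp
  then have "k \<noteq> 0"
    using \<open>\<alpha> \<noteq> 0\<close> pos[of 3] by auto
  \<comment> \<open>Subtracting \<open>r\<^sub>3 * cos \<theta>\<close> times \<open>e3\<close> from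
    the x-equation leaves only this.\<close>
  have "k * (r\<^sub>1 - r\<^sub>2) = 0"
    using body3(1) e3 h3 by algebra
  with \<open>k \<noteq> 0\<close> have r: "r\<^sub>2 = r\<^sub>1"
    by simp
  have "r\<^sub>1 * (\<alpha>\<^sup>2 * (h 1)\<^sup>2 - k * (1 + c)) = 0"
    using body1 unfolding h1 r by (simp add: algebra_simps power2_eq_square)
  then have e1: "\<alpha>\<^sup>2 * (h 1)\<^sup>2 = k * (1 + c)"
    using \<open>r\<^sub>1 > 0\<close> by simp
  have z: "q 2 0 $ 3 = q 1 0 $ 3"
    by (rule hyperbolic_sphere_height_unique[OF assms(1) sphere sphere]) (simp add: q r)
  \<comment> \<open>At equal heights, the side is a diameter of the common circle of bodies 1 and
    2.\<close>
  have \<rho>: "\<rho> = 2 * r\<^sub>1"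
  proof -
    have "lorentz (q 1 0 - q 2 0) (q 1 0 - q 2 0) = (2 * r\<^sub>1)\<^sup>2"
      by (simp add: lorentz_def q r z power2_eq_square)
    then show ?thesis
      using \<open>r\<^sub>1 > 0\<close> by (simp add: \<rho>_def chord_def real_sqrt_mult)
  qed
  then have c: "c = 2 * (h 1)\<^sup>2 - 1"
    unfolding c_def h1 by (simp add: power2_eq_square)
  have L: "lorentz (q 1 0 - q 3 0) (q 1 0 - q 3 0) = lorentz (q 1 0 - q 2 0) (q 1 0 - q 2 0)"
    "lorentz (q 1 0 - q 3 0) (q 1 0 - q 3 0) = lorentz (q 2 0 - q 3 0) (q 2 0 - q 3 0)"
    using sides by (simp_all add: chord_def)
  \<comment> \<open>Bodies 1 and 2 are now mirror images in the plane \<open>x = 0\<close>, and body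
    3 is equidistant from them.\<close>
  have "r\<^sub>1 * r\<^sub>3 * cos \<theta> = 0"
    using L(2) by (simp add: lorentz_def q r z algebra_simps)
  then have cos\<theta>: "cos \<theta> = 0"
    using \<open>r\<^sub>1 > 0\<close> \<open>r\<^sub>3 > 0\<close> by simp
  then have "(sin \<theta>)\<^sup>2 = 1"
    using sin_cos_squared_add[of \<theta>] by simp
  then have "r\<^sub>1\<^sup>2 + r\<^sub>3\<^sup>2 - (q 1 0 $ 3 - q 3 0 $ 3)\<^sup>2 = 4 * r\<^sub>1\<^sup>2"
    using L(1) by (simp add: lorentz_def q r z cos\<theta> power2_eq_square algebra_simps)
  moreover have "(h 1 - h 3)\<^sup>2 = - \<kappa> * (q 1 0 $ 3 - q 3 0 $ 3)\<^sup>2"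
    unfolding s2[symmetric] h_def by algebra
  \<comment> \<open>Multiply the side equality by \<open>- \<kappa>\<close> and replace each squared
    radius by its height: the squares cancel down to
    \<open>h 1 * h 3 = 2 * (h 1)\<^sup>2 - 1\<close>.\<close>
  ultimately have e13: "h 1 * h 3 = c"
    unfolding c using h1 h3 by algebra
  \<comment> \<open>Both products equal
    \<open>\<alpha>\<^sup>2 * (h 1)\<^sup>2 * (h 3)\<^sup>2\<close>, by \<open>e3\<close> and
    \<open>e1\<close>.\<close>
  have "k * (2 * c * (h 1)\<^sup>2 - (1 + c) * (h 3)\<^sup>2) = 0"
    using e1 e3 by algebra
  then have "2 * c * (h 1)\<^sup>2 - (1 + c) * (h 3)\<^sup>2 = 0"
    using \<open>k \<noteq> 0\<close> by simp
  \<comment> \<open>Here \<open>1 + c = 2 * (h 1)\<^sup>2\<close> lets the factor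
    \<open>2 * (h 1)\<^sup>2\<close> be pulled out.\<close>
  then have "(h 1)\<^sup>2 * (c - (h 3)\<^sup>2) = 0"
    using c by algebra
  then have "h 1 * h 3 = h 3 * h 3"
    using pos[of 1] e13 by (simp add: power2_eq_square)
  then have "h 1 = h 3"
    using pos[of 3] by simp
  \<comment> \<open>With equal heights, \<open>e13\<close> reads
    \<open>(h 1)\<^sup>2 = 2 * (h 1)\<^sup>2 - 1\<close>.\<close>
  then have "(h 1)\<^sup>2 = 1"
    using e13 c by (simp add: power2_eq_square)
  then show False
    using h1 assms(1) \<open>r\<^sub>1 > 0\<close> by simp
qed

end
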